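(* Any linear transformation $A\in\mathbb{F}_2^{n\times n}$ that preserves Hamming weight mod $4$ (i.e. $|Ax|\equiv|x|\pmod 4$ for all $x\in\mathbb{F}_2^n$) is also orthogonal (i.e. $(Ax)\cdot(Ay)\equiv x\cdot y\pmod 2$ for all $x,y\in\mathbb{F}_2^n$).
   Context: $|x|$ denotes the Hamming weight of $x\in\mathbb{F}_2^n=\{0,1\}^n$, and $x\cdot y=x_1y_1+\cdots+x_ny_n$. *)

theory Defs
  imports
    "HOL-Library.Z2"
    "HOL-Number_Theory.Cong"
    "Jordan_Normal_Form.Matrix"
begin

definition hamming_weight :: "bit vec \<Rightarrow> nat"
  where "hamming_weight x = card {i. i < dim_vec x \<and> x $ i \<noteq> 0}"

text \<open>
  The dot product of 0/1-vectors is taken in the natural numbers, so that it makes sense to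
  reduce it modulo 2. Its residue modulo 2 is the scalar product over the field \<^typ>\<open>bit\<close>.
\<close>

definition dot01 :: "bit vec \<Rightarrow> bit vec \<Rightarrow> nat"
  where "dot01 x y = map_vec of_bit x \<bullet> map_vec of_bit y"

lemma of_nat_dot01:
  assumes "dim_vec x = dim_vec y"
  shows "(of_nat (dot01 x y) :: bit) = x \<bullet> y"
proof -
  have *: "of_nat (of_bit a * of_bit b) = a * b" for a b :: bit
    by (cases a; cases b) simp_all
  have "dot01 x y = (\<Sum>i\<in>{0..<dim_vec y}. of_bit (x $ i) * of_bit (y $ i))"
    using assms by (simp add: dot01_def scalar_prod_def)
  then show ?thesis
    by (simp only: of_nat_sum * scalar_prod_def)
qed

lemma of_nat_bit_eq_iff_cong:
  "(of_nat a :: bit) = of_nat b \<longleftrightarrow> [a = b] (mod 2)"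
proof -
  have *: "(of_nat k :: bit) = of_bool (odd k)" for k :: nat
    by (induction k) auto
  show ?thesis
    unfolding * cong_def by (auto simp: mod2_eq_if)
qed

lemma dot01_cong_iff:
  assumes "dim_vec x = dim_vec y" and "dim_vec u = dim_vec v"
  shows "[dot01 x y = dot01 u v] (mod 2) \<longleftrightarrow> x \<bullet> y = u \<bullet> v"
  by (simp flip: of_nat_bit_eq_iff_cong add: of_nat_dot01 assms)

end

(*
  Since |x + y| + 2 (x \<cdot> y) = |x| + |y| in the natural numbers, the weights modulo 4 determine
  2 (x \<cdot> y) modulo 4, that is, x \<cdot> y modulo 2.
*)
theory Submission
  imports Defs
begin

text \<open>This is a polarization argument: modulo 4 the weight behaves like a quadratic form whose
  polar form is -2 times the dot product. Since \<open>A\<close> is additive, the identity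
  \<open>hamming_weight_add\<close> holds both for \<open>x\<close>, \<open>y\<close> and for their
  images; comparing the two modulo 4 leaves twice the dot products congruent, and halving gives the
  claim modulo 2.\<close>

lemma hamming_weight_eq_sum: "hamming_weight x = (\<Sum>i<dim_vec x. of_bit (x $ i))"
proof -
  have "of_bit b = (if b \<noteq> 0 then 1 else 0 :: nat)" for b :: bit
    by (cases b) simp_all
  then have "(\<Sum>i<dim_vec x. of_bit (x $ i)) = card ({..<dim_vec x} \<inter> {i. x $ i \<noteq> 0})"
    by (simp add: sum.If_cases)
  also have "{..<dim_vec x} \<inter> {i. x $ i \<noteq> 0} = {i. i < dim_vec x \<and> x $ i \<noteq> 0}"
    by auto
  finally show ?thesis
    by (simp add: hamming_weight_def)
qed

text \<open>A coordinate where both vectors are 1 is counted twice on the right and vanishes in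
  \<open>x + y\<close>, as 1 + 1 = 0 over \<open>bit\<close>. The additive form avoids truncated
  subtraction.\<close>

lemma hamming_weight_add:
  assumes "x \<in> carrier_vec n" and "y \<in> carrier_vec n"
  shows "hamming_weight (x + y) + 2 * dot01 x y = hamming_weight x + hamming_weight y"
proof -
  have bit: "of_bit (a + b) + 2 * (of_bit a * of_bit b) = (of_bit a + of_bit b :: nat)" for a b :: bit
    by (cases a; cases b) simp_all
  have "dot01 x y = (\<Sum>i<n. of_bit (x $ i) * of_bit (y $ i))"
    using assms by (simp add: dot01_def scalar_prod_def atLeast0LessThan)
  moreover have "hamming_weight (x + y) = (\<Sum>i<n. of_bit (x $ i + y $ i))"
    using assms by (simp add: hamming_weight_eq_sum)
  ultimately have "hamming_weight (x + y) + 2 * dot01 x y = (\<Sum>i<n. of_bit (x $ i) + of_bit (y $ i))"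
    by (simp only: sum_distrib_left flip: sum.distrib bit)
  then show ?thesis
    using assms by (simp add: hamming_weight_eq_sum sum.distrib)
qed

theorem corollary21:
  fixes n :: nat and A :: "bit mat"
  assumes "A \<in> carrier_mat n n"
    and "\<forall>x \<in> carrier_vec n. [hamming_weight (A *\<^sub>v x) = hamming_weight x] (mod 4)"
  shows "\<forall>x \<in> carrier_vec n. \<forall>y \<in> carrier_vec n.
           [dot01 (A *\<^sub>v x) (A *\<^sub>v y) = dot01 x y] (mod 2)"
proof (intro ballI)
  fix x y :: "bit vec"
  assume x: "x \<in> carrier_vec n" and y: "y \<in> carrier_vec n"
  have w: "[hamming_weight (A *\<^sub>v z) = hamming_weight z] (mod 4)" if "z \<in> carrier_vec n" for z
    using assms(2) that by blast
  \<comment> \<open>Linearity enters here: the image of \<open>x + y\<close> is the sum of the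
    images.\<close>
  have "hamming_weight (A *\<^sub>v (x + y)) + 2 * dot01 (A *\<^sub>v x) (A *\<^sub>v y)
      = hamming_weight (A *\<^sub>v x) + hamming_weight (A *\<^sub>v y)"
    using assms(1) x y hamming_weight_add[of "A *\<^sub>v x" n "A *\<^sub>v y"]
    by (simp add: mult_add_distrib_mat_vec[of A n n])
  also have "[\<dots> = hamming_weight x + hamming_weight y] (mod 4)"
    using w[OF x] w[OF y] by (rule cong_add)
  also have "hamming_weight x + hamming_weight y = hamming_weight (x + y) + 2 * dot01 x y"
    using hamming_weight_add[OF x y] by simp
  \<comment> \<open>Returning to the weight of the image gives both ends of the chain the same
    summand, which then cancels.\<close>
  also have "[\<dots> = hamming_weight (A *\<^sub>v (x + y)) + 2 * dot01 x y] (mod 4)"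
    using w[of "x + y"] x y by (intro cong_add) (simp_all add: cong_sym)
  \<comment> \<open>The modulus 4 is written \<open>2 * 2\<close> so that a factor 2 can be taken
    out of both sides and the modulus.\<close>
  finally have "[2 * dot01 (A *\<^sub>v x) (A *\<^sub>v y) = 2 * dot01 x y] (mod 2 * 2)"
    by (simp add: cong_add_lcancel_nat)
  then show "[dot01 (A *\<^sub>v x) (A *\<^sub>v y) = dot01 x y] (mod 2)"
    by (simp only: cong_def flip: mult_mod_right)
qed

end
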